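(* Let $\mathcal{H}$ be a real Hilbert space, let $f\in\Gamma_0(\mathcal{H})$ with $\operatorname{int}\operatorname{dom} f\neq\varnothing$ be Gâteaux differentiable on $\operatorname{int}\operatorname{dom} f$, let $m\ge 1$, and let $\mathcal{S}=\{q_0,q_1,\dots,q_m\}\subseteq\operatorname{int}\operatorname{dom} f$. Assume that $\overleftarrow{E}_f(\mathcal{S})\neq\varnothing$ and let $z\in\overleftarrow{E}_f(\mathcal{S})$. Set $L=\operatorname{span}\{\nabla f(q_1)-\nabla f(q_0),\dots,\nabla f(q_m)-\nabla f(q_0)\}$. Then the following hold. (i) $\overleftarrow{CC}_f(\mathcal{S})=\operatorname{aff}(\mathcal{S})\cap\operatorname{dom} f\cap(z+L^{\perp})$. (ii) Suppose that $\mathcal{H}=\mathbb{R}^n$, that $f$ is Legendre with $\operatorname{dom} f^*$ open, that $f$ allows forward Bregman projections, that $\operatorname{aff}(\mathcal{S})\subseteq\operatorname{int}\operatorname{dom} f$, and that $\nabla f(\operatorname{aff}(\mathcal{S}))$ is closed and convex and such that for every $i\in\{1,\dots,m\}$, $\pm(\nabla f(q_i)-\nabla f(q_0))\in\nabla f(\operatorname{aff}(\mathcal{S}))-\overleftarrow{P}^{f^*}_{\nabla f(\operatorname{aff}(\mathcal{S}))}(\nabla f(z))$ (e.g., $\nabla f(\operatorname{aff}(\mathcal{S}))$ is a closed affine subspace). Then $\overrightarrow{P}^{f}_{\operatorname{aff}(\mathcal{S})}(z)\in\overleftarrow{CC}_f(\mathcal{S})$.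
   Context: $\Gamma_0(\mathcal{H})$ is the set of proper closed convex functions $\mathcal{H}\to\,]-\infty,+\infty]$; $f^*$ is the Fenchel conjugate; $\operatorname{aff}$ denotes affine hull. The Bregman distance is $D_f(x,y)=f(x)-f(y)-\langle\nabla f(y),x-y\rangle$ if $y\in\operatorname{int}\operatorname{dom} f$, and $D_f(x,y)=+\infty$ otherwise. $\overleftarrow{E}_f(\mathcal{S})=\{x\in\operatorname{dom} f:\ D_f(x,q_0)=D_f(x,q_1)=\cdots=D_f(x,q_m)\}$, and the set of backward Bregman circumcenters of $\mathcal{S}$ is $\overleftarrow{CC}_f(\mathcal{S})=\operatorname{aff}(\mathcal{S})\cap\overleftarrow{E}_f(\mathcal{S})$. $f\in\Gamma_0(\mathcal{H})$ is Legendre if it is essentially smooth ($\operatorname{dom}\partial f=\operatorname{int}\operatorname{dom} f\neq\varnothing$, $f$ is Gâteaux differentiable on $\operatorname{int}\operatorname{dom} f$, and $\|\nabla f(x_k)\|\to+\infty$ for every sequence $(x_k)$ in $\operatorname{int}\operatorname{dom} f$ converging to a point of $\operatorname{bd}\operatorname{dom} f$) and essentially strictly convex ($(\partial f)^{-1}$ is locally bounded on its domain and $f$ is strictly convex on every convex subset of $\operatorname{dom}\partial f$). If $f$ is Legendre then so is $f^*$, and $\nabla f:\operatorname{int}\operatorname{dom} f\to\operatorname{int}\operatorname{dom} f^*$ is a bijection with inverse $\nabla f^*$. A Legendre function $f$ with $\operatorname{dom} f^*$ open allows forward Bregman projections if: $\nabla^2 f$ exists and is continuous on $\operatorname{int}\operatorname{dom}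 f$; $D_f$ is convex on $(\operatorname{int}\operatorname{dom} f)^2$; and for every $x\in\operatorname{int}\operatorname{dom} f$, $D_f(x,\cdot)$ is strictly convex on $\operatorname{int}\operatorname{dom} f$. For a nonempty set $C$ and a Legendre function $g$: for $y\in\operatorname{int}\operatorname{dom} g$, $\overleftarrow{P}^{g}_{C}(y)=\{u\in C\cap\operatorname{dom} g:\ (\forall c\in C)\ D_g(u,y)\le D_g(c,y)\}$; for $x\in\operatorname{dom} g$, $\overrightarrow{P}^{g}_{C}(x)=\{v\in C\cap\operatorname{int}\operatorname{dom} g:\ (\forall c\in C)\ D_g(x,v)\le D_g(x,c)\}$. When such a set is a singleton it is identified with its unique element; $A-p$ denotes $\{a-p: a\in A\}$. *)

theory Defs
  imports "HOL-Analysis.Analysis"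
begin

definition edom :: "('a \<Rightarrow> ereal) \<Rightarrow> 'a set" where
  "edom f = {x. f x < \<infinity>}"

definition epi :: "('a \<Rightarrow> ereal) \<Rightarrow> ('a \<times> real) set" where
  "epi f = {(x, r). f x \<le> ereal r}"

(* A function with values in ]-oo, +oo] is closed (lower semicontinuous), respectively convex,
   iff its epigraph is. *)
definition Gamma0 :: "('a::real_inner \<Rightarrow> ereal) set" where
  "Gamma0 = {f. (\<forall>x. f x \<noteq> -\<infinity>) \<and> edom f \<noteq> {} \<and> closed (epi f) \<and> convex (epi f)}"

definition fenchel_conj :: "('a::real_inner \<Rightarrow> ereal) \<Rightarrow> 'a \<Rightarrow> ereal" where
  "fenchel_conj f u = (SUP x. ereal (u \<bullet> x) - f x)"

(* Only meaningful at interior points of edom f: there f is finite near x, so the totalisation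
   by real_of_ereal is harmless. *)
definition has_gateaux_grad :: "('a::real_inner \<Rightarrow> ereal) \<Rightarrow> 'a \<Rightarrow> 'a \<Rightarrow> bool" where
  "has_gateaux_grad f g x \<longleftrightarrow>
     (\<forall>h. ((\<lambda>t. real_of_ereal (f (x + t *\<^sub>R h))) has_real_derivative (g \<bullet> h)) (at 0))"

definition gateaux_differentiable :: "('a::real_inner \<Rightarrow> ereal) \<Rightarrow> 'a \<Rightarrow> bool" where
  "gateaux_differentiable f x \<longleftrightarrow> (\<exists>g. has_gateaux_grad f g x)"

definition grad :: "('a::real_inner \<Rightarrow> ereal) \<Rightarrow> 'a \<Rightarrow> 'a" where
  "grad f x = (THE g. has_gateaux_grad f g x)"

definition bregman :: "('a::real_inner \<Rightarrow> ereal) \<Rightarrow> 'a \<Rightarrow> 'a \<Rightarrow> ereal" where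
  "bregman f x y =
     (if y \<in> interior (edom f) then f x - f y - ereal (grad f y \<bullet> (x - y)) else \<infinity>)"

definition bw_equidistant :: "('a::real_inner \<Rightarrow> ereal) \<Rightarrow> 'a set \<Rightarrow> 'a set" where
  "bw_equidistant f S = {x \<in> edom f. \<forall>p\<in>S. \<forall>q\<in>S. bregman f x p = bregman f x q}"

definition bw_circumcenters :: "('a::real_inner \<Rightarrow> ereal) \<Rightarrow> 'a set \<Rightarrow> 'a set" where
  "bw_circumcenters f S = affine hull S \<inter> bw_equidistant f S"

definition subdiff :: "('a::real_inner \<Rightarrow> ereal) \<Rightarrow> 'a \<Rightarrow> 'a set" where
  "subdiff f x = {u. \<forall>y. f x + ereal (u \<bullet> (y - x)) \<le> f y}"

definition dom_subdiff :: "('a::real_inner \<Rightarrow> ereal) \<Rightarrow> 'a set" where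
  "dom_subdiff f = {x. subdiff f x \<noteq> {}}"

definition strictly_convex_on :: "'a::real_vector set \<Rightarrow> ('a \<Rightarrow> real) \<Rightarrow> bool" where
  "strictly_convex_on C h \<longleftrightarrow> convex C \<and>
     (\<forall>x\<in>C. \<forall>y\<in>C. \<forall>u>0. \<forall>v>0. x \<noteq> y \<and> u + v = 1 \<longrightarrow>
        h (u *\<^sub>R x + v *\<^sub>R y) < u * h x + v * h y)"

definition essentially_smooth :: "('a::real_inner \<Rightarrow> ereal) \<Rightarrow> bool" where
  "essentially_smooth f \<longleftrightarrow>
     dom_subdiff f = interior (edom f) \<and> interior (edom f) \<noteq> {} \<and>
     (\<forall>x\<in>interior (edom f). gateaux_differentiable f x) \<and>
     (\<forall>X x. (\<forall>k::nat. X k \<in> interior (edom f)) \<and> x \<in> frontier (edom f) \<and> X \<longlonglongrightarrow> x \<longrightarrow>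
        filterlim (\<lambda>k. norm (grad f (X k))) at_top sequentially)"

definition essentially_strictly_convex :: "('a::real_inner \<Rightarrow> ereal) \<Rightarrow> bool" where
  "essentially_strictly_convex f \<longleftrightarrow>
     (\<forall>u\<in>(\<Union>x. subdiff f x). \<exists>e>0. bounded {x. subdiff f x \<inter> ball u e \<noteq> {}}) \<and>
     (\<forall>C. convex C \<and> C \<subseteq> dom_subdiff f \<longrightarrow> strictly_convex_on C (\<lambda>x. real_of_ereal (f x)))"

definition legendre :: "('a::real_inner \<Rightarrow> ereal) \<Rightarrow> bool" where
  "legendre f \<longleftrightarrow> f \<in> Gamma0 \<and> essentially_smooth f \<and> essentially_strictly_convex f"

(* The second derivative is the Frechet derivative of the gradient, with continuity in operator
   norm.  All Bregman distances occurring here are between interior points, hence finite. *)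
definition allows_forward_projections :: "('a::real_inner \<Rightarrow> ereal) \<Rightarrow> bool" where
  "allows_forward_projections f \<longleftrightarrow>
     (\<exists>H :: 'a \<Rightarrow> 'a \<Rightarrow>\<^sub>L 'a.
        (\<forall>x\<in>interior (edom f). (grad f has_derivative blinfun_apply (H x)) (at x)) \<and>
        continuous_on (interior (edom f)) H) \<and>
     convex_on (interior (edom f) \<times> interior (edom f)) (\<lambda>(x, y). real_of_ereal (bregman f x y)) \<and>
     (\<forall>x\<in>interior (edom f).
        strictly_convex_on (interior (edom f)) (\<lambda>y. real_of_ereal (bregman f x y)))"

definition bw_proj :: "('a::real_inner \<Rightarrow> ereal) \<Rightarrow> 'a set \<Rightarrow> 'a \<Rightarrow> 'a set" where
  "bw_proj g C y = {u \<in> C \<inter> edom g. \<forall>c\<in>C. bregman g u y \<le> bregman g c y}"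

definition fw_proj :: "('a::real_inner \<Rightarrow> ereal) \<Rightarrow> 'a set \<Rightarrow> 'a \<Rightarrow> 'a set" where
  "fw_proj g C x = {v \<in> C \<inter> interior (edom g). \<forall>c\<in>C. bregman g x v \<le> bregman g x c}"

(* "+-(grad f (q i) - grad f (q 0)) lies in K - p for i = 1, ..., m", where K is the image of the
   affine hull under grad f and p is the unique element of the backward projection, with respect
   to the conjugate, of grad f z onto K. *)
definition proj_condition ::
    "('a::real_inner \<Rightarrow> ereal) \<Rightarrow> nat \<Rightarrow> (nat \<Rightarrow> 'a) \<Rightarrow> 'a \<Rightarrow> bool" where
  "proj_condition f m q z \<longleftrightarrow>
     (let K = grad f ` (affine hull (q ` {0..m}));
          p = the_elem (bw_proj (fenchel_conj f) K (grad f z))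
      in \<forall>i\<in>{1..m}. grad f (q i) - grad f (q 0) \<in> (\<lambda>a. a - p) ` K \<and>
                     - (grad f (q i) - grad f (q 0)) \<in> (\<lambda>a. a - p) ` K)"

end

theory Submission
  imports Defs
begin

text \<open>
  For (i), the terms depending on \<open>x\<close> alone cancel in \<open>D\<^sub>f(x, p) = D\<^sub>f(x, q)\<close>, which leaves an affine
  equation in \<open>x\<close> with normal vector \<open>\<nabla>f(p) - \<nabla>f(q)\<close>.

  For (ii), \<open>\<nabla>f\<close> is continuous and injective on \<open>U = int dom f\<close>, so by invariance of domain it is a
  homeomorphism onto an open set. This yields \<open>\<nabla>f\<^sup>*(\<nabla>f(z)) = z\<close> and
  \<open>D\<^bsub>f\<^sup>*\<^esub>(\<nabla>f(y), \<nabla>f(z)) = D\<^sub>f(z, y)\<close>, whence \<open>\<nabla>f\<close> carries the forward projection of \<open>z\<close> onto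
  \<open>aff S\<close> to the backward projection of \<open>\<nabla>f(z)\<close> onto \<open>K = \<nabla>f(aff S)\<close>. A minimiser exists because
  \<open>f\<^sup>* - \<langle>z, \<cdot>\<rangle>\<close> is coercive for \<open>z \<in> U\<close>. If \<open>v\<close> is the forward projection, minimality over the
  convex set \<open>K\<close> gives \<open>\<langle>v - z, k - \<nabla>f(v)\<rangle> \<ge> 0\<close> for \<open>k \<in> K\<close>, and the two-sided condition on
  \<open>\<nabla>f(q\<^sub>i) - \<nabla>f(q\<^sub>0)\<close> turns this into the orthogonality required by (i).
\<close>

subsection \<open>Gradients of convex functions\<close>

lemma Gamma0_ereal:
  assumes "f \<in> Gamma0" "x \<in> edom f"
  shows "ereal (real_of_ereal (f x)) = f x"
proof -
  have "f x \<noteq> -\<infinity>" "f x \<noteq> \<infinity>" using assms by (auto simp: Gamma0_def edom_def)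
  then show ?thesis by (cases "f x") auto
qed

lemma Gamma0_convex_on:
  assumes "f \<in> Gamma0"
  shows "convex_on (edom f) (\<lambda>x. real_of_ereal (f x))"
proof -
  let ?F = "\<lambda>x. real_of_ereal (f x)"
  \<comment> \<open>Both conjuncts come from one inequality in the epigraph: its finite right-hand
    side puts the point in the domain, where it becomes an inequality of reals.\<close>
  have *: "u *\<^sub>R x + v *\<^sub>R y \<in> edom f \<and> ?F (u *\<^sub>R x + v *\<^sub>R y) \<le> u * ?F x + v * ?F y"
    if "x \<in> edom f" "y \<in> edom f" "0 \<le> u" "0 \<le> v" "u + v = 1" for x y u v
  proof -
    have "(x, ?F x) \<in> epi f" "(y, ?F y) \<in> epi f"
      using Gamma0_ereal[OF assms that(1)] Gamma0_ereal[OF assms that(2)] by (auto simp: epi_def)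
    moreover have "convex (epi f)" using assms by (simp add: Gamma0_def)
    ultimately have "u *\<^sub>R (x, ?F x) + v *\<^sub>R (y, ?F y) \<in> epi f"
      using that by (intro convexD)
    then have le: "f (u *\<^sub>R x + v *\<^sub>R y) \<le> ereal (u * ?F x + v * ?F y)"
      by (simp add: epi_def)
    then have dom: "u *\<^sub>R x + v *\<^sub>R y \<in> edom f"
      using order_le_less_trans[OF le, of \<infinity>] by (simp add: edom_def)
    then show ?thesis using le Gamma0_ereal[OF assms dom] by (metis ereal_less_eq(3))
  qed
  have "convex (edom f)" unfolding convex_def using * by blast
  then show ?thesis unfolding convex_on_def using * by blast
qed

lemma has_gateaux_grad_unique:
  assumes "has_gateaux_grad f g x" "has_gateaux_grad f g' x"
  shows "g = g'"
proof -
  have "g \<bullet> h = g' \<bullet> h" for h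
    using assms unfolding has_gateaux_grad_def by (meson DERIV_unique)
  then show ?thesis by (metis vector_eq_rdot)
qed

lemma grad_eqI: "has_gateaux_grad f g x \<Longrightarrow> grad f x = g"
  unfolding grad_def by (blast intro: the_equality has_gateaux_grad_unique)

lemma has_gateaux_grad_grad:
  "gateaux_differentiable f x \<Longrightarrow> has_gateaux_grad f (grad f x) x"
  unfolding gateaux_differentiable_def using grad_eqI by blast

text \<open>By convexity the difference quotients along the segment from \<open>x\<close> to
  \<open>y\<close> stay below \<open>?F y - ?F x\<close> for \<open>0 < t < 1\<close>; their limit
  from the right is the directional derivative.\<close>

lemma gradient_inequality:
  assumes f: "f \<in> Gamma0" and x: "x \<in> edom f" "gateaux_differentiable f x" and y: "y \<in> edom f"
  shows "real_of_ereal (f x) + grad f x \<bullet> (y - x) \<le> real_of_ereal (f y)"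
proof -
  let ?F = "\<lambda>x. real_of_ereal (f x)"
  let ?q = "\<lambda>t. (?F (x + t *\<^sub>R (y - x)) - ?F x) / t"
  have "((\<lambda>t. ?F (x + t *\<^sub>R (y - x))) has_real_derivative (grad f x \<bullet> (y - x))) (at 0)"
    using has_gateaux_grad_grad[OF x(2)] by (simp add: has_gateaux_grad_def)
  then have "(?q \<longlongrightarrow> grad f x \<bullet> (y - x)) (at 0)"
    by (simp add: has_field_derivative_def DERIV_def[unfolded has_field_derivative_def])
  then have "(?q \<longlongrightarrow> grad f x \<bullet> (y - x)) (at_right 0)"
    by (rule filterlim_mono) (auto simp: at_le)
  moreover have "\<forall>\<^sub>F t in at_right 0. ?q t \<le> ?F y - ?F x"
    unfolding eventually_at_right_field
  proof (intro exI[of _ 1] conjI allI impI)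
    fix t :: real assume t: "0 < t" "t < 1"
    have "?F ((1 - t) *\<^sub>R x + t *\<^sub>R y) \<le> (1 - t) * ?F x + t * ?F y"
      using Gamma0_convex_on[OF f] x y t by (intro convex_onD) auto
    moreover have "(1 - t) *\<^sub>R x + t *\<^sub>R y = x + t *\<^sub>R (y - x)" by (simp add: algebra_simps)
    ultimately show "?q t \<le> ?F y - ?F x" using t by (simp add: field_simps)
  qed simp
  ultimately have "grad f x \<bullet> (y - x) \<le> ?F y - ?F x"
    by (rule tendsto_upperbound) simp
  then show ?thesis by simp
qed

lemma bregman_ereal:
  assumes "f \<in> Gamma0" "x \<in> edom f" "y \<in> interior (edom f)"
  shows "bregman f x y =
    ereal (real_of_ereal (f x) - real_of_ereal (f y) - grad f y \<bullet> (x - y))"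
proof -
  have "y \<in> edom f" using assms(3) interior_subset by blast
  then show ?thesis
    using Gamma0_ereal[OF assms(1,2)] Gamma0_ereal[OF assms(1), of y] assms(3)
    by (metis bregman_def ereal_minus(1))
qed

subsection \<open>Circumcenters\<close>

text \<open>Subtracting the equation at \<open>z\<close> from the one at \<open>x\<close> also
  cancels the constants depending on \<open>p\<close> and \<open>q\<close>, so only the linear part
  survives.\<close>

lemma bregman_diff:
  assumes f: "f \<in> Gamma0" and "x \<in> edom f" "z \<in> edom f"
    and "p \<in> interior (edom f)" "q \<in> interior (edom f)" and z: "bregman f z p = bregman f z q"
  shows "bregman f x p = bregman f x q \<longleftrightarrow> (grad f p - grad f q) \<bullet> (x - z) = 0"
  using assms z by (simp add: bregman_ereal inner_diff_left inner_diff_right) argo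

lemma bw_equidistantD:
  "x \<in> bw_equidistant f S \<Longrightarrow> p \<in> S \<Longrightarrow> q \<in> S \<Longrightarrow> bregman f x p = bregman f x q"
  unfolding bw_equidistant_def by blast

lemma bw_equidistantI:
  "x \<in> edom f \<Longrightarrow> (\<And>p. p \<in> S \<Longrightarrow> bregman f x p = c) \<Longrightarrow> x \<in> bw_equidistant f S"
  by (simp add: bw_equidistant_def)

text \<open>Equidistance reduces to comparison with \<open>q 0\<close>; each comparison is
  orthogonality of \<open>x - z\<close> to one generator, which extends linearly to the
  span.\<close>

lemma bw_circumcenters_eq:
  fixes f :: "'a::real_inner \<Rightarrow> ereal" and q :: "nat \<Rightarrow> 'a"
  assumes f: "f \<in> Gamma0" and S: "q ` {0..m} \<subseteq> interior (edom f)"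
    and z: "z \<in> bw_equidistant f (q ` {0..m})"
  shows "bw_circumcenters f (q ` {0..m}) = affine hull (q ` {0..m}) \<inter> edom f \<inter>
    (\<lambda>w. z + w) ` orthogonal_comp (span ((\<lambda>i. grad f (q i) - grad f (q 0)) ` {1..m}))"
    (is "_ = _ \<inter> _ \<inter> _ ` orthogonal_comp (span ?B)")
proof -
  have zd: "z \<in> edom f" using z by (simp add: bw_equidistant_def)
  have iff: "x \<in> bw_equidistant f (q ` {0..m}) \<longleftrightarrow> x - z \<in> orthogonal_comp (span ?B)"
    if x: "x \<in> edom f" for x
  proof -
    have "x \<in> bw_equidistant f (q ` {0..m}) \<longleftrightarrow> (\<forall>i\<le>m. bregman f x (q i) = bregman f x (q 0))"
    proof
      assume "x \<in> bw_equidistant f (q ` {0..m})"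
      then show "\<forall>i\<le>m. bregman f x (q i) = bregman f x (q 0)"
        by (intro allI impI, elim bw_equidistantD) simp_all
    next
      assume E: "\<forall>i\<le>m. bregman f x (q i) = bregman f x (q 0)"
      have "bregman f x p = bregman f x (q 0)" if "p \<in> q ` {0..m}" for p
        using that E by (metis atLeastAtMost_iff imageE)
      then show "x \<in> bw_equidistant f (q ` {0..m})"
        by (rule bw_equidistantI[OF x])
    qed
    also have "\<dots> \<longleftrightarrow> (\<forall>i\<le>m. (grad f (q i) - grad f (q 0)) \<bullet> (x - z) = 0)"
    proof -
      have "bregman f x (q i) = bregman f x (q 0) \<longleftrightarrow>
          (grad f (q i) - grad f (q 0)) \<bullet> (x - z) = 0" if i: "i \<le> m" for i
      proof (rule bregman_diff[OF f x zd])
        show "bregman f z (q i) = bregman f z (q 0)"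
          using z i by (elim bw_equidistantD) simp_all
      qed (use S i in auto)
      then show ?thesis by simp
    qed
    also have "\<dots> \<longleftrightarrow> (\<forall>b\<in>?B. b \<bullet> (x - z) = 0)"
    proof
      assume B: "\<forall>b\<in>?B. b \<bullet> (x - z) = 0"
      show "\<forall>i\<le>m. (grad f (q i) - grad f (q 0)) \<bullet> (x - z) = 0"
      proof (intro allI impI)
        fix i assume "i \<le> m"
        then show "(grad f (q i) - grad f (q 0)) \<bullet> (x - z) = 0"
          \<comment> \<open>The generators in \<open>?B\<close> start at index 1; at index 0 the
            normal vector is zero.\<close>
          using B by (cases "i = 0") simp_all
      qed
    qed simp
    also have "\<dots> \<longleftrightarrow> (\<forall>b\<in>span ?B. b \<bullet> (x - z) = 0)"
    proof
      assume B: "\<forall>b\<in>?B. b \<bullet> (x - z) = 0"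
      show "\<forall>b\<in>span ?B. b \<bullet> (x - z) = 0"
      proof
        fix b assume "b \<in> span ?B"
        then have "orthogonal (x - z) b"
        proof (rule orthogonal_to_span)
          fix y assume "y \<in> ?B"
          with B have "y \<bullet> (x - z) = 0" by (rule bspec)
          then show "orthogonal (x - z) y" unfolding orthogonal_def by (subst inner_commute)
        qed
        then show "b \<bullet> (x - z) = 0" unfolding orthogonal_def by (subst inner_commute)
      qed
    next
      assume B: "\<forall>b\<in>span ?B. b \<bullet> (x - z) = 0"
      show "\<forall>b\<in>?B. b \<bullet> (x - z) = 0" by (intro ballI bspec[OF B] span_base)
    qed
    finally show ?thesis by (simp add: orthogonal_comp_def orthogonal_def)
  qed
  have img: "x \<in> (\<lambda>w. z + w) ` orthogonal_comp (span ?B) \<longleftrightarrow> x - z \<in> orthogonal_comp (span ?B)"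
    for x by (metis (no_types, lifting) add_diff_cancel_left' diff_add_cancel add.commute image_iff)
  have "x \<in> edom f" if "x \<in> bw_equidistant f (q ` {0..m})" for x
    using that by (simp add: bw_equidistant_def)
  then show ?thesis unfolding bw_circumcenters_def using iff img by blast
qed

subsection \<open>Duality of the projections\<close>

text \<open>Continuity of the gradient is what invariance of domain asks for; it is obtained later
  from the second derivative.\<close>

locale smooth_legendre =
  fixes f :: "'a::euclidean_space \<Rightarrow> ereal"
  assumes legendre: "legendre f"
    and grad_continuous: "continuous_on (interior (edom f)) (grad f)"
begin

abbreviation U where "U \<equiv> interior (edom f)"
abbreviation F where "F \<equiv> \<lambda>x. real_of_ereal (f x)"

lemma Gamma0: "f \<in> Gamma0"
  using legendre by (simp add: legendre_def)

lemma U_edom: "x \<in> U \<Longrightarrow> x \<in> edom f"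
  using interior_subset by blast

lemma F_ereal: "x \<in> U \<Longrightarrow> ereal (F x) = f x"
  using Gamma0_ereal[OF Gamma0 U_edom] .

lemma differentiable: "x \<in> U \<Longrightarrow> gateaux_differentiable f x"
  using legendre by (simp add: legendre_def essentially_smooth_def)

lemma grad_ineq: "x \<in> U \<Longrightarrow> y \<in> edom f \<Longrightarrow> F x + grad f x \<bullet> (y - x) \<le> F y"
  using gradient_inequality[OF Gamma0 U_edom differentiable] .

lemma convex_U: "convex U"
  using Gamma0_convex_on[OF Gamma0] convex_interior convex_on_imp_convex by blast

lemma F_continuous: "continuous_on U F"
  using Gamma0_convex_on[OF Gamma0] convex_U interior_subset
  by (intro convex_on_continuous) (auto intro: convex_on_subset)

text \<open>With equal gradients, the gradient inequality at \<open>x\<close> tested at the midpoint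
  and the one at \<open>y\<close> tested at \<open>x\<close> together bound \<open>F\<close> at the
  midpoint below by the average of \<open>F x\<close> and \<open>F y\<close>, against strict
  convexity.\<close>

lemma inj_on_grad: "inj_on (grad f) U"
proof (rule inj_onI, rule ccontr)
  fix x y assume xy: "x \<in> U" "y \<in> U" "grad f x = grad f y" "x \<noteq> y"
  have "dom_subdiff f = U"
    using legendre by (simp add: legendre_def essentially_smooth_def)
  then have "strictly_convex_on U F"
    using legendre convex_U by (simp add: legendre_def essentially_strictly_convex_def)
  then have *: "F ((1/2) *\<^sub>R x + (1/2) *\<^sub>R y) < (1/2) * F x + (1/2) * F y"
    using xy unfolding strictly_convex_on_def by (metis field_sum_of_halves half_gt_zero zero_less_one)
  have mid: "(1/2) *\<^sub>R x + (1/2) *\<^sub>R y \<in> U"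
    using xy convex_U by (intro convexD) auto
  have "F x + grad f x \<bullet> ((1/2) *\<^sub>R x + (1/2) *\<^sub>R y - x) \<le> F ((1/2) *\<^sub>R x + (1/2) *\<^sub>R y)"
    using grad_ineq[OF xy(1) U_edom[OF mid]] .
  moreover have "grad f x \<bullet> ((1/2) *\<^sub>R x + (1/2) *\<^sub>R y - x) = (grad f y \<bullet> y - grad f y \<bullet> x) / 2"
    using xy(3) by (simp add: inner_diff_right inner_add_right)
  moreover have "F y + grad f y \<bullet> (x - y) \<le> F x" using grad_ineq[OF xy(2) U_edom[OF xy(1)]] .
  then have "F y + (grad f y \<bullet> x - grad f y \<bullet> y) \<le> F x" by (simp add: inner_diff_right)
  ultimately show False using * by argo
qed

section \<open>The inverse gradient and the conjugate\<close>

text \<open>On the range of the gradient this is the gradient of the conjugate, as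
  \<open>grad_conj\<close> shows.\<close>

definition G where "G = inv_into U (grad f)"

lemma G_grad [simp]: "x \<in> U \<Longrightarrow> G (grad f x) = x"
  unfolding G_def using inj_on_grad by (rule inv_into_f_f)

text \<open>Openness keeps small perturbations of a gradient inside the range, where
  \<open>conj_grad\<close> gives the conjugate in closed form.\<close>

lemma open_range: "open (grad f ` U)"
  using grad_continuous inj_on_grad by (intro invariance_of_domain) auto

lemma G_continuous: "continuous_on (grad f ` U) G"
  using grad_continuous by (intro continuous_on_inverse_open) auto

text \<open>The equality case of Fenchel-Young: by the gradient inequality the supremum is attained
  at \<open>y\<close>.\<close>

lemma conj_grad:
  assumes "y \<in> U"
  shows "fenchel_conj f (grad f y) = ereal (grad f y \<bullet> y - F y)"
  unfolding fenchel_conj_def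
proof (intro antisym SUP_least)
  fix x
  show "ereal (grad f y \<bullet> x) - f x \<le> ereal (grad f y \<bullet> y - F y)"
  proof (cases "x \<in> edom f")
    case True
    then have "ereal (grad f y \<bullet> x) - f x = ereal (grad f y \<bullet> x - F x)"
      by (metis Gamma0 Gamma0_ereal ereal_minus(1))
    then show ?thesis using grad_ineq[OF assms True] by (simp add: inner_diff_right)
  qed (simp add: edom_def)
next
  have "ereal (grad f y \<bullet> y - F y) = ereal (grad f y \<bullet> y) - f y"
    by (metis F_ereal[OF assms] ereal_minus(1))
  then show "ereal (grad f y \<bullet> y - F y) \<le> (SUP x. ereal (grad f y \<bullet> x) - f x)"
    by (intro SUP_upper2[of y]) auto
qed

lemma grad_edom_conj: "y \<in> U \<Longrightarrow> grad f y \<in> interior (edom (fenchel_conj f))"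
  by (rule interiorI[OF open_range]) (auto simp: edom_def conj_grad)

text \<open>The gradient inequality at \<open>y\<close> tested at \<open>x\<close>. Read through
  \<open>conj_grad\<close>, it is the subgradient inequality of the conjugate at
  \<open>grad f x\<close> with subgradient \<open>x\<close>, tested on the range.\<close>

lemma conj_grad_ineq:
  assumes "x \<in> U" "y \<in> U"
  shows "(grad f x \<bullet> x - F x) + x \<bullet> (grad f y - grad f x) \<le> grad f y \<bullet> y - F y"
  using grad_ineq[OF assms(2) U_edom[OF assms(1)]]
  by (simp add: inner_diff_right inner_commute)

text \<open>For either sign of \<open>t\<close>, \<open>conj_grad_ineq\<close> used in both
  directions squeezes the increment of the conjugate between \<open>t * (z \<bullet> h)\<close> and
  \<open>t * (y \<bullet> h)\<close> with \<open>y = G (?w t)\<close>. Continuity of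
  \<open>G\<close> then makes the error of the difference quotient vanish.\<close>

lemma grad_conj:
  assumes z: "z \<in> U"
  shows "grad (fenchel_conj f) (grad f z) = z"
proof (rule grad_eqI, unfold has_gateaux_grad_def, intro allI)
  fix h
  let ?w = "\<lambda>t. grad f z + t *\<^sub>R h"
  let ?\<phi> = "\<lambda>t. real_of_ereal (fenchel_conj f (?w t))"
  have V: "grad f z \<in> grad f ` U" using z by (rule imageI)
  have "(?w \<longlongrightarrow> grad f z + 0 *\<^sub>R h) (at 0)"
    by (intro tendsto_intros)
  then have w: "(?w \<longlongrightarrow> grad f z) (at 0)" by simp
  then have inV: "\<forall>\<^sub>F t in at 0. ?w t \<in> grad f ` U"
    using open_range V by (rule topological_tendstoD)
  have "isCont G (grad f z)"
    using G_continuous V unfolding continuous_on_eq_continuous_at[OF open_range] by (rule bspec)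
  then have "((\<lambda>t. G (?w t)) \<longlongrightarrow> G (grad f z)) (at 0)"
    using w by (rule isCont_tendsto_compose)
  then have "((\<lambda>t. (G (?w t) - z) \<bullet> h) \<longlongrightarrow> (G (grad f z) - z) \<bullet> h) (at 0)"
    by (intro tendsto_intros)
  then have lim: "((\<lambda>t. (G (?w t) - z) \<bullet> h) \<longlongrightarrow> 0) (at 0)" using z by simp
  have "\<forall>\<^sub>F t in at 0. norm ((?\<phi> t - ?\<phi> 0) / t - z \<bullet> h) \<le> norm ((G (?w t) - z) \<bullet> h)"
    using inV eventually_neq_at_within[of 0]
  proof eventually_elim
    case (elim t)
    then obtain y where y: "y \<in> U" "grad f y = ?w t" by auto
    have \<phi>: "?\<phi> t = ?w t \<bullet> y - F y" "?\<phi> 0 = grad f z \<bullet> z - F z"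
      using conj_grad[OF y(1)] conj_grad[OF z] y by simp_all
    have "t * (z \<bullet> h) \<le> ?\<phi> t - ?\<phi> 0" "?\<phi> t - ?\<phi> 0 \<le> t * (y \<bullet> h)"
      using conj_grad_ineq[OF z y(1)] conj_grad_ineq[OF y(1) z] y(2) \<phi> by simp_all
    then have "\<bar>?\<phi> t - ?\<phi> 0 - t * (z \<bullet> h)\<bar> \<le> \<bar>t * ((y - z) \<bullet> h)\<bar>"
      by (simp add: inner_diff_left algebra_simps)
    then have "\<bar>(?\<phi> t - ?\<phi> 0 - t * (z \<bullet> h)) / t\<bar> \<le> \<bar>t * ((y - z) \<bullet> h) / t\<bar>"
      unfolding abs_divide by (rule divide_right_mono) simp
    then have "\<bar>(?\<phi> t - ?\<phi> 0) / t - z \<bullet> h\<bar> \<le> \<bar>(y - z) \<bullet> h\<bar>"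
      using elim(2) by (simp add: diff_divide_distrib)
    moreover have "G (?w t) = y" using y G_grad by metis
    ultimately show ?case by simp
  qed
  then have "((\<lambda>t. (?\<phi> t - ?\<phi> 0) / t - z \<bullet> h) \<longlongrightarrow> 0) (at 0)"
    using lim tendsto_norm_zero[OF lim] by (rule_tac Lim_null_comparison)
  then show "(?\<phi> has_real_derivative z \<bullet> h) (at 0)"
    by (simp add: DERIV_def Lim_null[of _ "z \<bullet> h"])
qed

section \<open>Transfer of distances and projections to the conjugate\<close>

lemma bregman_U:
  "x \<in> U \<Longrightarrow> y \<in> U \<Longrightarrow> bregman f x y = ereal (F x - F y - grad f y \<bullet> (x - y))"
  using bregman_ereal[OF Gamma0 U_edom] .

lemma bregman_conj:
  assumes "y \<in> U" "z \<in> U"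
  shows "bregman (fenchel_conj f) (grad f y) (grad f z) = bregman f z y"
  using assms grad_edom_conj
  by (simp add: bregman_U bregman_def[of "fenchel_conj f"] grad_conj conj_grad inner_diff_right
      inner_commute)

lemma bw_proj_conj:
  assumes "A \<subseteq> U" "z \<in> U"
  shows "bw_proj (fenchel_conj f) (grad f ` A) (grad f z) = grad f ` fw_proj f A z"
proof -
  have "grad f y \<in> edom (fenchel_conj f)" if "y \<in> A" for y
    using grad_edom_conj[of y] interior_subset assms(1) that by blast
  moreover have "bregman (fenchel_conj f) (grad f y) (grad f z) = bregman f z y" if "y \<in> A" for y
    using bregman_conj assms that by blast
  ultimately show ?thesis
    using assms(1) unfolding bw_proj_def fw_proj_def by auto
qed

text \<open>Testing the gradient inequality on a ball around \<open>z\<close>, where \<open>f\<close> is bounded, makes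
  \<open>f\<^sup>* - \<langle>z, \<cdot>\<rangle>\<close> coercive.\<close>

lemma coercive:
  assumes "z \<in> U"
  obtains r M where "r > 0"
    "\<And>y. y \<in> U \<Longrightarrow> r * norm (grad f y) - M \<le> grad f y \<bullet> y - F y - z \<bullet> grad f y"
proof -
  obtain r where r: "r > 0" "cball z r \<subseteq> U"
    using assms open_contains_cball[of U] open_interior by blast
  have "compact (F ` cball z r)"
    using F_continuous r(2) by (intro compact_continuous_image) (auto intro: continuous_on_subset)
  then obtain M where M: "\<And>x. x \<in> cball z r \<Longrightarrow> F x \<le> M"
    using compact_imp_bounded bounded_has_Sup(1) r(1) by (metis bounded_imp_bdd_above bdd_above.E imageI)
  show thesis
  proof (rule that[OF r(1)])
    fix y assume y: "y \<in> U"
    \<comment> \<open>In the direction of the gradient the linear term gains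
      \<open>r * norm (grad f y)\<close>; a zero gradient makes \<open>?x\<close> equal to
      \<open>z\<close>.\<close>
    let ?x = "z + r *\<^sub>R sgn (grad f y)"
    have x: "?x \<in> cball z r" using r(1) by (simp add: dist_norm norm_sgn)
    have "F y + grad f y \<bullet> (?x - y) \<le> M"
      using grad_ineq[OF y U_edom, of ?x] x r(2) M[OF x] by (meson order_trans subsetD)
    moreover have "grad f y \<bullet> sgn (grad f y) = norm (grad f y)"
      by (cases "grad f y = 0") (simp_all add: sgn_div_norm dot_square_norm power2_eq_square)
    ultimately show "r * norm (grad f y) - M \<le> grad f y \<bullet> y - F y - z \<bullet> grad f y"
      by (simp add: inner_diff_right inner_add_right inner_commute)
  qed
qed

section \<open>Existence, first-order condition and uniqueness of the forward projection\<close>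

text \<open>The minimisation moves to the dual variable, where the objective is coercive and the
  feasible set closed, so a truncation to a ball is compact.\<close>

lemma fw_proj_nonempty:
  assumes A: "A \<subseteq> U" "A \<noteq> {}" "closed (grad f ` A)" and z: "z \<in> U"
  shows "fw_proj f A z \<noteq> {}"
proof -
  \<comment> \<open>The conjugate minus \<open>z \<bullet> w\<close>, written through
    \<open>G\<close>; at \<open>w = grad f y\<close> it equals the Bregman distance from
    \<open>z\<close> to \<open>y\<close> minus the constant \<open>F z\<close>.\<close>
  let ?D = "\<lambda>w. w \<bullet> G w - F (G w) - z \<bullet> w"
  have GU: "G ` grad f ` U \<subseteq> U" by auto
  have D: "continuous_on (grad f ` U) ?D"
    by (intro continuous_intros G_continuous continuous_on_compose2[OF F_continuous G_continuous GU])
  obtain r M where r: "r > 0"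
    "\<And>y. y \<in> U \<Longrightarrow> r * norm (grad f y) - M \<le> grad f y \<bullet> y - F y - z \<bullet> grad f y"
    using coercive[OF z] by blast
  obtain a where a: "a \<in> A" using A(2) by blast
  \<comment> \<open>Beyond this radius the coercive lower bound exceeds the value at
    \<open>grad f a\<close>, so a minimiser inside the ball is global.\<close>
  let ?R = "(?D (grad f a) + M) / r"
  have far: "?D (grad f a) < ?D (grad f y)" if "y \<in> A" "norm (grad f y) > ?R" for y
    using r(1) r(2)[of y] that A(1) by (simp add: field_simps subset_iff)
  have "a \<in> U" using a A(1) by blast
  then have aK: "grad f a \<in> grad f ` A \<inter> cball 0 ?R"
    using r(1) r(2)[of a] a by (simp add: field_simps)
  moreover have "compact (grad f ` A \<inter> cball 0 ?R)"
    using A(3) by (simp add: closed_Int_compact)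
  moreover have "continuous_on (grad f ` A \<inter> cball 0 ?R) ?D"
    using D A(1) by (elim continuous_on_subset) auto
  ultimately obtain p where p: "p \<in> grad f ` A \<inter> cball 0 ?R"
    "\<And>w. w \<in> grad f ` A \<inter> cball 0 ?R \<Longrightarrow> ?D p \<le> ?D w"
    using continuous_attains_inf[of "grad f ` A \<inter> cball 0 ?R" ?D] by blast
  then obtain v where v: "v \<in> A" "p = grad f v" by blast
  have "bregman f z v \<le> bregman f z y" if y: "y \<in> A" for y
  proof -
    have "?D p \<le> ?D (grad f y)"
    proof (cases "norm (grad f y) > ?R")
      case True
      then show ?thesis using far[OF y] p(2)[OF aK] by simp
    next
      case False
      then show ?thesis using p(2)[of "grad f y"] y by simp
    qed
    then show ?thesis
      using y v A(1) z by (simp add: subset_iff bregman_U inner_diff_right inner_commute)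
  qed
  then show ?thesis using v(1) A(1) unfolding fw_proj_def by blast
qed

text \<open>The dual segment from \<open>grad f v\<close> to \<open>k\<close> stays in the convex
  image; the inequality is proved with \<open>G (?w t)\<close> in place of \<open>v\<close> and then
  passed to the limit.\<close>

lemma fw_proj_variational:
  assumes A: "A \<subseteq> U" "convex (grad f ` A)" and z: "z \<in> U"
    and v: "v \<in> fw_proj f A z" and k: "k \<in> grad f ` A"
  shows "0 \<le> (v - z) \<bullet> (k - grad f v)"
proof -
  let ?w = "\<lambda>t. grad f v + t *\<^sub>R (k - grad f v)"
  have vA: "v \<in> A" using v by (simp add: fw_proj_def)
  have vU: "v \<in> U" using vA A(1) by blast
  have "0 \<le> (G (?w t) - z) \<bullet> (k - grad f v)" if t: "0 < t" "t < 1" for t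
  proof -
    have "(1 - t) *\<^sub>R grad f v + t *\<^sub>R k \<in> grad f ` A"
      using vA t k by (intro convexD A(2)) auto
    then have "?w t \<in> grad f ` A" by (simp add: algebra_simps)
    then obtain y where y: "y \<in> A" "grad f y = ?w t" by auto
    have yU: "y \<in> U" using y(1) A(1) by blast
    have "bregman f z v \<le> bregman f z y" using v y(1) by (simp add: fw_proj_def)
    then have "grad f v \<bullet> v - F v - z \<bullet> grad f v \<le> grad f y \<bullet> y - F y - z \<bullet> grad f y"
      using yU vU z by (simp add: bregman_U inner_diff_right inner_commute)
    \<comment> \<open>Taking the subgradient inequality at the moving point \<open>grad f y\<close>
      bounds the increment of the conjugate from above, while minimality of \<open>v\<close> bounds
      it from below by \<open>z \<bullet> (grad f y - grad f v)\<close>.\<close>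
    moreover have "(grad f y \<bullet> y - F y) + y \<bullet> (grad f v - grad f y) \<le> grad f v \<bullet> v - F v"
      using conj_grad_ineq[OF yU vU] .
    ultimately have "0 \<le> (y - z) \<bullet> (grad f y - grad f v)"
      by (simp add: inner_diff_right inner_diff_left)
    also have "\<dots> = t * ((y - z) \<bullet> (k - grad f v))" using y(2) by simp
    finally have "0 \<le> (y - z) \<bullet> (k - grad f v)" using t by (simp add: zero_le_mult_iff)
    moreover have "G (?w t) = y" using y(2) yU G_grad by metis
    ultimately show ?thesis by simp
  qed
  then have "\<forall>\<^sub>F t in at_right 0. 0 \<le> (G (?w t) - z) \<bullet> (k - grad f v)"
    unfolding eventually_at_right_field by (metis zero_less_one)
  moreover have "((\<lambda>t. (G (?w t) - z) \<bullet> (k - grad f v)) \<longlongrightarrow> (v - z) \<bullet> (k - grad f v)) (at_right 0)"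
  proof -
    have "isCont G (grad f v)"
      using G_continuous imageI[OF vU]
      unfolding continuous_on_eq_continuous_at[OF open_range] by (rule bspec)
    moreover have "(?w \<longlongrightarrow> grad f v + 0 *\<^sub>R (k - grad f v)) (at_right 0)"
      by (intro tendsto_intros)
    then have "(?w \<longlongrightarrow> grad f v) (at_right 0)" by simp
    ultimately have "((\<lambda>t. G (?w t)) \<longlongrightarrow> G (grad f v)) (at_right 0)"
      by (rule isCont_tendsto_compose)
    then have "((\<lambda>t. (G (?w t) - z) \<bullet> (k - grad f v)) \<longlongrightarrow> (G (grad f v) - z) \<bullet> (k - grad f v)) (at_right 0)"
      by (intro tendsto_intros)
    then show ?thesis using vU by simp
  qed
  ultimately show ?thesis by (rule_tac tendsto_lowerbound) auto
qed

text \<open>Two distinct minimisers would be beaten by their midpoint; here \<open>A\<close> itself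
  is convex, rather than its gradient image.\<close>

lemma fw_proj_unique:
  assumes strict: "strictly_convex_on U (\<lambda>y. real_of_ereal (bregman f z y))"
    and A: "convex A" "A \<subseteq> U" and z: "z \<in> U"
    and "v \<in> fw_proj f A z" "w \<in> fw_proj f A z"
  shows "v = w"
proof (rule ccontr)
  assume "v \<noteq> w"
  let ?D = "\<lambda>y. real_of_ereal (bregman f z y)" and ?c = "(1/2) *\<^sub>R v + (1/2) *\<^sub>R w"
  have vw: "v \<in> A" "w \<in> A" using assms by (auto simp: fw_proj_def)
  have c: "?c \<in> A" using A(1) vw by (intro convexD) auto
  have "?D ?c < (1/2) * ?D v + (1/2) * ?D w"
    using strict vw A(2) \<open>v \<noteq> w\<close> unfolding strictly_convex_on_def
    by (metis field_sum_of_halves half_gt_zero zero_less_one subsetD)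
  moreover have "bregman f z v \<le> bregman f z ?c" "bregman f z w \<le> bregman f z ?c"
    using assms(5,6) c by (auto simp: fw_proj_def)
  then have "?D v \<le> ?D ?c" "?D w \<le> ?D ?c"
    using vw c A(2) z by (simp_all add: bregman_U subset_iff)
  ultimately show False by simp
qed

lemma fw_proj_singleton:
  assumes "strictly_convex_on U (\<lambda>y. real_of_ereal (bregman f z y))"
    and "convex A" "A \<subseteq> U" "A \<noteq> {}" "closed (grad f ` A)" "z \<in> U"
  obtains v where "fw_proj f A z = {v}"
proof -
  obtain v where "v \<in> fw_proj f A z" using fw_proj_nonempty assms by blast
  then have "fw_proj f A z = {v}" using fw_proj_unique[OF assms(1-3,6)] by blast
  then show thesis by (rule that)
qed

end

lemma allows_forward_projections_grad_continuous:
  assumes "allows_forward_projections f"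
  shows "continuous_on (interior (edom f)) (grad f)"
  using assms unfolding allows_forward_projections_def
  by (meson continuous_at_imp_continuous_on has_derivative_continuous)

lemma smooth_legendreI:
  "legendre f \<Longrightarrow> allows_forward_projections f \<Longrightarrow> smooth_legendre f"
  by (simp add: smooth_legendre_def allows_forward_projections_grad_continuous)

subsection \<open>The forward projection as a circumcenter\<close>

text \<open>A singleton forward projection makes the dual projection the singleton of
  \<open>grad f v\<close>, so \<open>the_elem\<close> has its intended value and the condition
  becomes membership of translates of \<open>grad f v\<close>.\<close>

lemma proj_condition_iff:
  fixes f :: "'a::euclidean_space \<Rightarrow> ereal"
  assumes "legendre f" "allows_forward_projections f" "z \<in> interior (edom f)"
    and "affine hull (q ` {0..m}) \<subseteq> interior (edom f)"
    and "fw_proj f (affine hull (q ` {0..m})) z = {v}"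
  shows "proj_condition f m q z \<longleftrightarrow> (\<forall>i\<in>{1..m}.
    grad f v + (grad f (q i) - grad f (q 0)) \<in> grad f ` (affine hull (q ` {0..m})) \<and>
    grad f v + (grad f (q 0) - grad f (q i)) \<in> grad f ` (affine hull (q ` {0..m})))"
proof -
  interpret smooth_legendre f using assms by (intro smooth_legendreI)
  have sub: "x \<in> (\<lambda>a. a - p) ` K \<longleftrightarrow> p + x \<in> K" for x p and K :: "'a set"
    by (metis (no_types, lifting) add_diff_cancel_left' diff_add_cancel add.commute image_iff)
  have "the_elem (bw_proj (fenchel_conj f) (grad f ` (affine hull (q ` {0..m}))) (grad f z)) = grad f v"
    using bw_proj_conj[OF assms(4,3)] assms(5) by simp
  then show ?thesis unfolding proj_condition_def Let_def sub by simp
qed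

lemma fw_proj_in_bw_circumcenters:
  fixes f :: "'a::euclidean_space \<Rightarrow> ereal"
  assumes "legendre f" "allows_forward_projections f" and z: "z \<in> interior (edom f)"
    and A: "affine hull (q ` {0..m}) \<subseteq> interior (edom f)"
    and K: "convex (grad f ` (affine hull (q ` {0..m})))"
    and v: "fw_proj f (affine hull (q ` {0..m})) z = {v}"
    and zE: "z \<in> bw_equidistant f (q ` {0..m})" and cond: "proj_condition f m q z"
  shows "v \<in> bw_circumcenters f (q ` {0..m})"
proof -
  interpret smooth_legendre f using assms by (intro smooth_legendreI)
  let ?B = "(\<lambda>i. grad f (q i) - grad f (q 0)) ` {1..m}"
    and ?K = "grad f ` (affine hull (q ` {0..m}))"
  have vA: "v \<in> affine hull (q ` {0..m})" using v by (auto simp: fw_proj_def)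
  have orth: "orthogonal (v - z) b" if "b \<in> ?B" for b
  proof -
    have "grad f v + b \<in> ?K" "grad f v + (- b) \<in> ?K"
      using cond that unfolding proj_condition_iff[OF assms(1,2) z A v]
      by (auto simp del: add_uminus_conv_diff)
    \<comment> \<open>The test points on both sides of \<open>grad f v\<close> bound the inner
      product with \<open>b\<close> from both directions, which forces it to vanish.\<close>
    then have "0 \<le> (v - z) \<bullet> (grad f v + b - grad f v)"
      "0 \<le> (v - z) \<bullet> (grad f v + (- b) - grad f v)"
      by (intro fw_proj_variational[OF A K z]; simp add: v)+
    then show ?thesis by (simp add: orthogonal_def)
  qed
  have "v - z \<in> orthogonal_comp (span ?B)"
    unfolding orthogonal_comp_def using orthogonal_to_span[OF _ orth]
    by (intro CollectI ballI) (simp only: orthogonal_commute)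
  then have "v \<in> (\<lambda>w. z + w) ` orthogonal_comp (span ?B)"
    by (rule rev_image_eqI) simp
  moreover have S: "q ` {0..m} \<subseteq> U" by (rule order_trans[OF hull_subset A])
  moreover have "v \<in> edom f" using vA A by (intro U_edom) (rule subsetD)
  ultimately show ?thesis
    unfolding bw_circumcenters_eq[OF Gamma0 S zE] using vA by (intro IntI)
qed

text \<open>An affine set is closed under adding the difference of two of its points to a third;
  \<open>grad f v\<close> and all \<open>grad f (q i)\<close> lie in the image.\<close>

lemma affine_proj_condition:
  fixes f :: "'a::euclidean_space \<Rightarrow> ereal"
  assumes "legendre f" "allows_forward_projections f" "z \<in> interior (edom f)"
    and "affine hull (q ` {0..m}) \<subseteq> interior (edom f)"
    and K: "affine (grad f ` (affine hull (q ` {0..m})))"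
    and v: "fw_proj f (affine hull (q ` {0..m})) z = {v}"
  shows "proj_condition f m q z"
proof -
  let ?K = "grad f ` (affine hull (q ` {0..m}))"
  have v': "grad f v \<in> ?K" using v by (auto simp: fw_proj_def)
  have q: "grad f (q i) \<in> ?K" if "i \<le> m" for i
    using that by (auto intro!: imageI hull_inc)
  have "a + 1 *\<^sub>R (b - c) \<in> ?K" if "a \<in> ?K" "b \<in> ?K" "c \<in> ?K" for a b c
    using K that by (rule mem_affine_3_minus)
  then have "grad f v + (grad f (q i) - grad f (q 0)) \<in> ?K"
    "grad f v + (grad f (q 0) - grad f (q i)) \<in> ?K" if "i \<le> m" for i
    using v' q that by (metis scaleR_one le0)+
  then show ?thesis
    unfolding proj_condition_iff[OF assms(1-4) v] by simp
qed

theorem theorem3p7: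
  shows
    "(\<forall>(f :: 'a::{real_inner,complete_space} \<Rightarrow> ereal) (m::nat) (q :: nat \<Rightarrow> 'a) S z L.
        f \<in> Gamma0 \<and> interior (edom f) \<noteq> {} \<and>
        (\<forall>x\<in>interior (edom f). gateaux_differentiable f x) \<and>
        m \<ge> 1 \<and> S = q ` {0..m} \<and> S \<subseteq> interior (edom f) \<and>
        bw_equidistant f S \<noteq> {} \<and> z \<in> bw_equidistant f S \<and>
        L = span ((\<lambda>i. grad f (q i) - grad f (q 0)) ` {1..m})
        \<longrightarrow> bw_circumcenters f S = affine hull S \<inter> edom f \<inter> (\<lambda>w. z + w) ` orthogonal_comp L)
     \<and>
     (\<forall>(f :: real^'n \<Rightarrow> ereal) (m::nat) (q :: nat \<Rightarrow> real^'n) S z K.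
        f \<in> Gamma0 \<and> interior (edom f) \<noteq> {} \<and>
        (\<forall>x\<in>interior (edom f). gateaux_differentiable f x) \<and>
        m \<ge> 1 \<and> S = q ` {0..m} \<and> S \<subseteq> interior (edom f) \<and>
        bw_equidistant f S \<noteq> {} \<and> z \<in> bw_equidistant f S \<and>
        legendre f \<and> open (edom (fenchel_conj f)) \<and> allows_forward_projections f \<and>
        z \<in> interior (edom f) \<and> affine hull S \<subseteq> interior (edom f) \<and>
        K = grad f ` (affine hull S)
        \<longrightarrow> (closed K \<and> convex K \<and> proj_condition f m q z
              \<longrightarrow> (\<exists>v. fw_proj f (affine hull S) z = {v} \<and> v \<in> bw_circumcenters f S))
          \<and> (closed K \<and> affine K \<longrightarrow> convex K \<and> proj_condition f m q z))"
proof (rule conjI; intro allI impI; elim conjE)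
  fix f :: "'a \<Rightarrow> ereal" and m and q :: "nat \<Rightarrow> 'a" and S z L
  assume "f \<in> Gamma0" and S: "S = q ` {0..m}" and "S \<subseteq> interior (edom f)" "z \<in> bw_equidistant f S"
    and L: "L = span ((\<lambda>i. grad f (q i) - grad f (q 0)) ` {1..m})"
  then show "bw_circumcenters f S = affine hull S \<inter> edom f \<inter> (\<lambda>w. z + w) ` orthogonal_comp L"
    unfolding S L by (intro bw_circumcenters_eq)
next
  fix f :: "real^'n \<Rightarrow> ereal" and m and q :: "nat \<Rightarrow> real^'n" and S z K
  assume S: "S = q ` {0..m}" and zE: "z \<in> bw_equidistant f S"
    and f: "legendre f" "allows_forward_projections f"
    and z: "z \<in> interior (edom f)" and A: "affine hull S \<subseteq> interior (edom f)"
    and K: "K = grad f ` (affine hull S)"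
  interpret smooth_legendre f using f by (rule smooth_legendreI)
  have strict: "strictly_convex_on U (\<lambda>y. real_of_ereal (bregman f z y))"
    using f(2) z by (simp add: allows_forward_projections_def)
  have ne: "affine hull S \<noteq> {}" using S by simp
  \<comment> \<open>Closedness of \<open>K\<close> gives existence, strict convexity of the distance
    on the convex affine hull uniqueness; both claims below start from this singleton.\<close>
  have sing: "\<exists>v. fw_proj f (affine hull S) z = {v}" if "closed K"
    using fw_proj_singleton[OF strict affine_imp_convex[OF affine_affine_hull] A ne _ z] that
    unfolding K by metis
  show "(closed K \<and> convex K \<and> proj_condition f m q z
        \<longrightarrow> (\<exists>v. fw_proj f (affine hull S) z = {v} \<and> v \<in> bw_circumcenters f S))
      \<and> (closed K \<and> affine K \<longrightarrow> convex K \<and> proj_condition f m q z)"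
  proof (intro conjI impI; elim conjE)
    assume "closed K" "convex K" "proj_condition f m q z"
    moreover from \<open>closed K\<close> obtain v where "fw_proj f (affine hull S) z = {v}" using sing by auto
    ultimately show "\<exists>v. fw_proj f (affine hull S) z = {v} \<and> v \<in> bw_circumcenters f S"
      using fw_proj_in_bw_circumcenters[OF f z A[unfolded S]] zE unfolding S K by metis
  next
    assume "affine K"
    then show "convex K" by (rule affine_imp_convex)
  next
    assume "closed K" "affine K"
    moreover from \<open>closed K\<close> obtain v where "fw_proj f (affine hull S) z = {v}" using sing by auto
    ultimately show "proj_condition f m q z"
      using affine_proj_condition[OF f z A[unfolded S]] unfolding S K by metis
  qed
qed

end
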